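(* Assume the Continuum Hypothesis. Let $\mathfrak{c}=2^{\omega}$. If $X$ and $Y$ are dense subsets of $(2^{\mathfrak{c}})_\delta$, each of cardinality $\mathfrak{c}$, then $X$ and $Y$ (with the subspace topologies inherited from $(2^{\mathfrak{c}})_\delta$) are homeomorphic.
   Context: For a $T_1$-space $X$, the $G_\delta$-modification $(X)_\delta$ is the set $X$ endowed with the topology generated by all $G_\delta$-subsets of $X$. For an infinite cardinal $\kappa$, $2^{\kappa}$ is the Cantor cube $\{0,1\}^{\kappa}$ with the product topology ($\{0,1\}$ discrete), and $(2^{\kappa})_\delta$ is its $G_\delta$-modification; a base for $(2^\kappa)_\delta$ consists of the sets $[f]=\{g\in 2^\kappa : f\subseteq g\}$, where $f\colon A\to\{0,1\}$ and $A\subseteq\kappa$ is countable. *)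

theory Defs
  imports "HOL-Analysis.Analysis"
begin

unbundle cardinal_syntax

definition Gdelta_modification :: "'a topology \<Rightarrow> 'a topology" where
  "Gdelta_modification X = topology_generated_by {S. gdelta_in X S}"

definition Cantor_cube :: "'i set \<Rightarrow> ('i \<Rightarrow> bool) topology" where
  "Cantor_cube I = product_topology (\<lambda>_. discrete_topology (UNIV :: bool set)) I"

definition dense_in :: "'a topology \<Rightarrow> 'a set \<Rightarrow> bool" where
  "dense_in X D \<longleftrightarrow> D \<subseteq> topspace X \<and> X closure_of D = topspace X"

definition continuum :: "(nat \<Rightarrow> bool) rel" where
  "continuum = ctwo ^c natLeq"

text \<open>\<^const>\<open>natLeq\<close> is the cardinal $\omega$, so its successor cardinal is $\omega_1$.\<close>

definition Continuum_Hypothesis :: bool where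
  "Continuum_Hypothesis \<longleftrightarrow> continuum =o cardSuc natLeq"

end

theory Submission
  imports Defs "HOL-Library.Countable_Set_Type"
begin

text \<open>
  Under CH the index set carries a well-order of type $\omega_1$, so the sets of all points that
  agree with a given point up to a given index form a base of the $G_\delta$-modification. A partial
  isometry for this tree structure between countable subsets of $X$ and $Y$ extends to any further
  point: the image of that point only has to take prescribed values at countably many indices, and
  density supplies it. A back-and-forth recursion of length $\omega_1$ then yields an isometry of
  $X$ onto $Y$.
\<close>

section \<open>Neighbourhoods in the Cantor cube and in its G_delta-modification\<close>

lemma openin_Cantor_cube_finite_support:
  assumes "openin (Cantor_cube I) U" "g \<in> U"
  shows "\<exists>C. finite C \<and> C \<subseteq> I \<and>
    (\<forall>g' \<in> topspace (Cantor_cube I). (\<forall>i\<in>C. g' i = g i) \<longrightarrow> g' \<in> U)"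
proof -
  obtain V where V: "finite {i \<in> I. V i \<noteq> UNIV}" "g \<in> Pi\<^sub>E I V" "Pi\<^sub>E I V \<subseteq> U"
    using assms unfolding Cantor_cube_def openin_product_topology_alt by fastforce
  have "g' \<in> U" if g': "g' \<in> topspace (Cantor_cube I)" "\<forall>i\<in>{i \<in> I. V i \<noteq> UNIV}. g' i = g i" for g'
  proof -
    have "g' \<in> Pi\<^sub>E I V"
    proof (rule PiE_I)
      fix i assume i: "i \<in> I"
      show "g' i \<in> V i"
      proof (cases "V i = UNIV")
        case False
        then have "g' i = g i" using g'(2) i by blast
        then show ?thesis using PiE_mem[OF V(2) i] by simp
      qed simp
    next
      fix i assume "i \<notin> I"
      then show "g' i = undefined" using g'(1) by (auto simp: Cantor_cube_def PiE_def extensional_def)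
    qed
    then show ?thesis using V by blast
  qed
  then show ?thesis using V(1) by (intro exI[of _ "{i \<in> I. V i \<noteq> UNIV}"]) blast
qed

lemma gdelta_in_Cantor_cube_box:
  assumes "countable C" "C \<subseteq> I"
  shows "gdelta_in (Cantor_cube I) {g \<in> topspace (Cantor_cube I). \<forall>i\<in>C. g i = z i}"
\<comment> \<open>The empty \<open>C\<close> is treated apart because an intersection over the empty
  family would be the whole type, not the cube.\<close>
proof (cases "C = {}")
  case False
  let ?B = "\<lambda>i. {g \<in> topspace (Cantor_cube I). g i \<in> {z i}}"
  have "openin (Cantor_cube I) (?B i)" if "i \<in> C" for i
  proof (rule openin_continuous_map_preimage)
    show "continuous_map (Cantor_cube I) (discrete_topology UNIV) (\<lambda>g. g i)"
      unfolding Cantor_cube_def by (rule continuous_map_product_projection) (use that assms in blast)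
  qed auto
  then have "gdelta_in (Cantor_cube I) (\<Inter>(?B ` C))"
    using False assms(1) by (intro gdelta_in_Inter) (auto intro: open_imp_gdelta_in)
  moreover have "\<Inter>(?B ` C) = {g \<in> topspace (Cantor_cube I). \<forall>i\<in>C. g i = z i}"
    using False by auto
  ultimately show ?thesis by simp
qed simp

lemma topspace_Gdelta_modification [simp]:
  "topspace (Gdelta_modification X) = topspace X"
proof -
  have "topspace X \<in> {S. gdelta_in X S}" by simp
  moreover have "S \<subseteq> topspace X" if "S \<in> {S. gdelta_in X S}" for S
    using that by (simp add: gdelta_in_subset)
  ultimately have "\<Union> {S. gdelta_in X S} = topspace X" by blast
  then show ?thesis by (simp add: Gdelta_modification_def)
qed

text \<open>Induction over the generation of the topology. A G_delta set is a countable intersection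
  of open sets, each with a finite support at \<open>g\<close>, so the union of these supports is
  countable. A binary intersection joins two supports, and a union inherits the support of a member
  containing \<open>g\<close>.\<close>

lemma openin_Gdelta_Cantor_cube_support:
  assumes "openin (Gdelta_modification (Cantor_cube I)) U" "g \<in> U"
  shows "\<exists>C. countable C \<and> C \<subseteq> I \<and>
    (\<forall>g' \<in> topspace (Cantor_cube I). (\<forall>i\<in>C. g' i = g i) \<longrightarrow> g' \<in> U)"
proof -
  have "generate_topology_on {S. gdelta_in (Cantor_cube I) S} U"
    using assms(1) by (simp add: Gdelta_modification_def openin_topology_generated_by)
  then show ?thesis using assms(2)
  proof (induction U)
    case Empty
    then show ?case by simp
  next
    case (Int U V)
    from Int.IH Int.prems obtain C D where "countable C \<and> C \<subseteq> I \<and>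
        (\<forall>g' \<in> topspace (Cantor_cube I). (\<forall>i\<in>C. g' i = g i) \<longrightarrow> g' \<in> U)"
      "countable D \<and> D \<subseteq> I \<and>
        (\<forall>g' \<in> topspace (Cantor_cube I). (\<forall>i\<in>D. g' i = g i) \<longrightarrow> g' \<in> V)"
      by (metis IntD1 IntD2)
    then show ?case by (intro exI[of _ "C \<union> D"]) simp
  next
    case (UN K)
    then obtain U where U: "U \<in> K" "g \<in> U" by blast
    then have "U \<subseteq> \<Union>K" by blast
    then show ?case using UN.IH[OF U] by (meson subsetD)
  next
    case (Basis S)
    then have "(countable intersection_of openin (Cantor_cube I)) S"
      by (simp add: gdelta_in_alt)
    then obtain \<U> where \<U>: "countable \<U>" "\<And>U. U \<in> \<U> \<Longrightarrow> openin (Cantor_cube I) U" "S = \<Inter>\<U>"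
      unfolding intersection_of_def by blast
    have "\<exists>C. finite C \<and> C \<subseteq> I \<and>
        (\<forall>g' \<in> topspace (Cantor_cube I). (\<forall>i\<in>C. g' i = g i) \<longrightarrow> g' \<in> U)" if "U \<in> \<U>" for U
      by (rule openin_Cantor_cube_finite_support) (use \<U> Basis that in auto)
    then obtain C where C: "\<And>U. U \<in> \<U> \<Longrightarrow> finite (C U) \<and> C U \<subseteq> I \<and>
        (\<forall>g' \<in> topspace (Cantor_cube I). (\<forall>i\<in>C U. g' i = g i) \<longrightarrow> g' \<in> U)"
      by metis
    have "countable (\<Union>(C ` \<U>))" using \<U>(1) C by (auto intro: countable_finite)
    then show ?case using C \<U>(3) by (intro exI[of _ "\<Union>(C ` \<U>)"]) (simp add: UN_least)
  qed
qed

lemma openin_Gdelta_Cantor_cube_box: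
  assumes "countable C" "C \<subseteq> I"
  shows "openin (Gdelta_modification (Cantor_cube I))
    {g \<in> topspace (Cantor_cube I). \<forall>i\<in>C. g i = z i}"
  unfolding Gdelta_modification_def
  by (rule topology_generated_by_Basis) (simp add: gdelta_in_Cantor_cube_box[OF assms])

lemma dense_in_Gdelta_Cantor_cubeD:
  assumes dense: "dense_in (Gdelta_modification (Cantor_cube I)) X"
    and C: "countable C" "C \<subseteq> I"
  shows "\<exists>x\<in>X. \<forall>i\<in>C. x i = z i"
proof -
  let ?B = "{g \<in> topspace (Cantor_cube I). \<forall>i\<in>C. g i = z i}"
  \<comment> \<open>\<open>z\<close> is an arbitrary function; restricting it makes it a point of
    the cube, whose elements are \<open>undefined\<close> outside \<open>I\<close>.\<close>
  have z: "restrict z I \<in> ?B" using C by (auto simp: Cantor_cube_def)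
  have "restrict z I \<in> Gdelta_modification (Cantor_cube I) closure_of X"
    using dense z by (simp add: dense_in_def)
  then have "\<forall>T. restrict z I \<in> T \<and> openin (Gdelta_modification (Cantor_cube I)) T \<longrightarrow>
      (\<exists>x. x \<in> X \<and> x \<in> T)"
    unfolding in_closure_of by (rule conjunct2)
  from mp[OF spec[OF this] conjI[OF z openin_Gdelta_Cantor_cube_box[OF C]]]
  show ?thesis by auto
qed

section \<open>Back-and-forth along a well-order with countable initial segments\<close>

text \<open>Stage \<open>i\<close> starts from the union of the earlier stages, which is countable
  because \<open>underS r i\<close> is, and then adds \<open>a i\<close> on the left and
  \<open>b i\<close> on the right. Compatibility survives unions because it concerns only two pairs
  at a time and the stages form a chain.\<close>

lemma transfinite_back_and_forth:
  fixes r :: "'i rel"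
  assumes wo: "well_order_on I r" and seg: "\<And>i. countable (underS r i)"
    and X: "X = a ` I" and Y: "Y = b ` I"
    and forward: "\<And>F x. \<lbrakk>countable F; F \<subseteq> X \<times> Y; \<forall>p\<in>F. \<forall>q\<in>F. P p q; x \<in> X\<rbrakk> \<Longrightarrow>
      \<exists>y\<in>Y. \<forall>p\<in>insert (x, y) F. \<forall>q\<in>insert (x, y) F. P p q"
    and backward: "\<And>F y. \<lbrakk>countable F; F \<subseteq> X \<times> Y; \<forall>p\<in>F. \<forall>q\<in>F. P p q; y \<in> Y\<rbrakk> \<Longrightarrow>
      \<exists>x\<in>X. \<forall>p\<in>insert (x, y) F. \<forall>q\<in>insert (x, y) F. P p q"
  obtains F where "F \<subseteq> X \<times> Y" "\<forall>p\<in>F. \<forall>q\<in>F. P p q" "fst ` F = X" "snd ` F = Y"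
proof -
  define good where "good F \<longleftrightarrow> countable F \<and> F \<subseteq> X \<times> Y \<and> (\<forall>p\<in>F. \<forall>q\<in>F. P p q)" for F
  define step where
    "step i F = (SOME G. good G \<and> F \<subseteq> G \<and> a i \<in> fst ` G \<and> b i \<in> snd ` G)" for i F
  have step: "good (step i F) \<and> F \<subseteq> step i F \<and> a i \<in> fst ` step i F \<and> b i \<in> snd ` step i F"
    if F0: "good F" and i: "i \<in> I" for i F
  proof -
    have ai: "a i \<in> X" and bi: "b i \<in> Y" using i X Y by blast+
    obtain y where y: "y \<in> Y" "\<forall>p\<in>insert (a i, y) F. \<forall>q\<in>insert (a i, y) F. P p q"
      using forward[of F "a i"] F0 ai unfolding good_def by metis
    let ?F = "insert (a i, y) F"
    have F: "good ?F" using F0 ai y unfolding good_def by simp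
    obtain x where x: "x \<in> X" "\<forall>p\<in>insert (x, b i) ?F. \<forall>q\<in>insert (x, b i) ?F. P p q"
      using backward[of ?F "b i"] F bi unfolding good_def by metis
    have "good (insert (x, b i) ?F)" using F x bi unfolding good_def by simp
    then have "\<exists>G. good G \<and> F \<subseteq> G \<and> a i \<in> fst ` G \<and> b i \<in> snd ` G"
      by (intro exI[of _ "insert (x, b i) ?F"]) auto
    then show ?thesis unfolding step_def by (rule someI_ex)
  qed
  define R where "R = wfrec (r - Id) (\<lambda>R i. step i (\<Union>j\<in>underS r i. R j))"
  have wf: "wf (r - Id)" and tot: "total_on I r" and rI: "r \<subseteq> I \<times> I"
    using wo by (auto simp: well_order_on_def linear_order_on_def partial_order_on_def
        preorder_on_def refl_on_def)
  have R: "R i = step i (\<Union>j\<in>underS r i. R j)" for i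
  proof -
    have "(\<Union>j\<in>underS r i. cut R (r - Id) i j) = (\<Union>j\<in>underS r i. R j)"
      by (intro SUP_cong refl) (auto simp: cut_apply underS_def)
    then show ?thesis using wfrec[OF wf, of "\<lambda>R i. step i (\<Union>j\<in>underS r i. R j)" i]
      unfolding R_def[symmetric] by simp
  qed
  \<comment> \<open>The induction is about the union below \<open>i\<close>, since
    \<open>step\<close> is under control only when its argument is already good.\<close>
  have good_below: "good (\<Union>j\<in>underS r i. R j)" if "i \<in> I" for i
    using wf that
  proof (induction i rule: wf_induct_rule)
    case (less i)
    have IH: "good (R j)" "(\<Union>k\<in>underS r j. R k) \<subseteq> R j" if "j \<in> underS r i" for j
    proof -
      have "j \<in> I" "good (\<Union>k\<in>underS r j. R k)"
        using that less.IH[of j] rI by (auto simp: underS_def)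
      then show "good (R j)" "(\<Union>k\<in>underS r j. R k) \<subseteq> R j"
        using step R[of j] by auto
    qed
    have "P p q" if "p \<in> R j" "q \<in> R k" "j \<in> underS r i" "k \<in> underS r i" for p q j k
    proof -
      \<comment> \<open>Of two stages the later contains the earlier, so any two pairs lie together
        in one good stage.\<close>
      have "j = k \<or> j \<in> underS r k \<or> k \<in> underS r j"
        using tot that(3,4) rI by (auto simp: total_on_def underS_def)
      then have "\<exists>l\<in>underS r i. p \<in> R l \<and> q \<in> R l" using IH(2) that by blast
      then show ?thesis using IH(1) unfolding good_def by blast
    qed
    moreover have "countable (\<Union>j\<in>underS r i. R j)"
      using seg IH(1) by (auto simp: good_def)
    ultimately show ?case using IH(1) unfolding good_def by blast
  qed
  have Rstep: "good (R i)" "(\<Union>j\<in>underS r i. R j) \<subseteq> R i" "a i \<in> fst ` R i" "b i \<in> snd ` R i"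
    if "i \<in> I" for i
    using step[OF good_below[OF that] that] R[of i] by auto
  have sub: "(\<Union>i\<in>I. R i) \<subseteq> X \<times> Y" using Rstep(1) by (auto simp: good_def)
  have "P p q" if "p \<in> R i" "q \<in> R j" "i \<in> I" "j \<in> I" for p q i j
  proof -
    have "i = j \<or> i \<in> underS r j \<or> j \<in> underS r i"
      using tot that(3,4) by (auto simp: total_on_def underS_def)
    then have "\<exists>l\<in>I. p \<in> R l \<and> q \<in> R l" using Rstep(2) that by blast
    then show ?thesis using Rstep(1) unfolding good_def by blast
  qed
  moreover have "fst ` (\<Union>i\<in>I. R i) = X"
  proof
    show "X \<subseteq> fst ` (\<Union>i\<in>I. R i)" using Rstep(3) unfolding X by blast
  qed (use sub in fastforce)
  moreover have "snd ` (\<Union>i\<in>I. R i) = Y"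
  proof
    show "Y \<subseteq> snd ` (\<Union>i\<in>I. R i)" using Rstep(4) unfolding Y by blast
  qed (use sub in fastforce)
  ultimately show ?thesis using sub by (intro that[of "\<Union>i\<in>I. R i"]) blast+
qed

section \<open>Agreement along the order as a tree structure\<close>

text \<open>The segment is closed: agreement through \<open>i\<close> also fixes the value at
  \<open>i\<close>. The equivalence classes are the nodes of the tree.\<close>

definition agree :: "'i rel \<Rightarrow> 'i \<Rightarrow> ('i \<Rightarrow> bool) \<Rightarrow> ('i \<Rightarrow> bool) \<Rightarrow> bool" where
  "agree r i f g \<longleftrightarrow> (\<forall>j\<in>under r i. f j = g j)"

text \<open>This is the isometry condition for the ultrametric given by the first difference: over a
  well-order, the two first coordinates split at the same index as the two second coordinates, or
  neither pair splits.\<close>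

definition agree_alike ::
    "'i rel \<Rightarrow> ('i \<Rightarrow> bool) \<times> ('i \<Rightarrow> bool) \<Rightarrow> ('i \<Rightarrow> bool) \<times> ('i \<Rightarrow> bool) \<Rightarrow> bool" where
  "agree_alike r p q \<longleftrightarrow>
    (\<forall>i\<in>Field r. agree r i (fst p) (fst q) \<longleftrightarrow> agree r i (snd p) (snd q))"

lemma agree_refl [simp]: "agree r i f f"
  by (simp add: agree_def)

lemma agree_sym: "agree r i f g \<Longrightarrow> agree r i g f"
  by (simp add: agree_def)

lemma agree_trans: "\<lbrakk>agree r i f g; agree r i g h\<rbrakk> \<Longrightarrow> agree r i f h"
  by (simp add: agree_def)

lemma agree_alike_sym: "agree_alike r p q \<Longrightarrow> agree_alike r q p"
  unfolding agree_alike_def by (meson agree_sym)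

lemma agree_alike_refl [simp]: "agree_alike r p p"
  by (simp add: agree_alike_def)

lemma agree_alike_swap [simp]:
  "agree_alike r (prod.swap p) (prod.swap q) \<longleftrightarrow> agree_alike r p q"
  by (auto simp: agree_alike_def)

text \<open>Together the conditions say that the order type is omega_1. Countable segments make the
  agreement classes open; uncountability provides bounds for countable sets of indices.\<close>

locale omega1_order =
  fixes I :: "'i set" and r :: "'i rel"
  assumes wo: "well_order_on I r"
    and countable_underS: "countable (underS r i)"
    and uncountable: "uncountable I"
begin

lemma Field_r: "Field r = I"
  using well_order_on_Field[OF wo] by simp

lemma wf_r: "wf (r - Id)"
  using wo by (simp add: well_order_on_def)

lemma trans_r: "(i, j) \<in> r \<Longrightarrow> (j, k) \<in> r \<Longrightarrow> (i, k) \<in> r"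
  using wo unfolding well_order_on_def linear_order_on_def partial_order_on_def preorder_on_def
  by (meson transE)

lemma refl_r: "i \<in> I \<Longrightarrow> (i, i) \<in> r"
  using wo unfolding well_order_on_def linear_order_on_def partial_order_on_def preorder_on_def
  by (meson refl_onD)

lemma linear_r: "i \<in> I \<Longrightarrow> j \<in> I \<Longrightarrow> (i, j) \<notin> r \<Longrightarrow> (j, i) \<in> r \<and> i \<noteq> j"
  using wo refl_r unfolding well_order_on_def linear_order_on_def total_on_def by metis

lemma r_dom: "(i, j) \<in> r \<Longrightarrow> i \<in> I \<and> j \<in> I"
  using Field_r FieldI1 FieldI2 by metis

lemma least_ex:
  assumes "i \<in> S" "S \<subseteq> I"
  obtains m where "m \<in> S" "\<And>j. j \<in> S \<Longrightarrow> (m, j) \<in> r"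
proof -
  obtain m where m: "m \<in> S" "\<And>j. (j, m) \<in> r - Id \<Longrightarrow> j \<notin> S"
    using wfE_min[OF wf_r assms(1)] by metis
  show ?thesis
    using m assms(2) linear_r by (intro that[of m]) blast+
qed

lemma countable_under: "countable (under r i)"
proof (rule countable_subset)
  show "under r i \<subseteq> insert i (underS r i)" by (auto simp: under_def underS_def)
qed (simp add: countable_underS)

text \<open>Regularity of omega_1: countably many countable segments cannot exhaust
  \<open>I\<close>, and an index outside all of them lies above every element of
  \<open>C\<close>.\<close>

lemma bounded_ex:
  assumes "countable C" "C \<subseteq> I"
  obtains i where "i \<in> I" "C \<subseteq> under r i"
proof -
  have "countable (\<Union>c\<in>C. under r c)" using assms countable_under by simp
  then have "\<not> I \<subseteq> (\<Union>c\<in>C. under r c)" using uncountable countable_subset by blast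
  then obtain i where "i \<in> I" "\<And>c. c \<in> C \<Longrightarrow> (i, c) \<notin> r" by (auto simp: under_def)
  then show ?thesis using assms linear_r by (intro that[of i]) (auto simp: under_def)
qed

lemma agree_mono: "agree r i f g \<Longrightarrow> (j, i) \<in> r \<Longrightarrow> agree r j f g"
  unfolding agree_def under_def using trans_r by blast

lemma first_difference:
  assumes "i \<in> I" "\<not> agree r i f g"
  obtains d where "(d, i) \<in> r" "f d \<noteq> g d" "\<And>j. (j, d) \<in> r \<Longrightarrow> j \<noteq> d \<Longrightarrow> agree r j f g"
proof -
  obtain k where k: "(k, i) \<in> r" "f k \<noteq> g k" using assms by (auto simp: agree_def under_def)
  let ?S = "{j \<in> I. f j \<noteq> g j}"
  have "k \<in> ?S" "?S \<subseteq> I" using k r_dom by auto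
  then obtain d where d: "d \<in> ?S" "\<And>j. j \<in> ?S \<Longrightarrow> (d, j) \<in> r"
    by (rule least_ex) blast
  show ?thesis
  proof (rule that)
    show "(d, i) \<in> r" using d(2)[OF \<open>k \<in> ?S\<close>] k trans_r by blast
    show "f d \<noteq> g d" using d by simp
    show "agree r j f g" if "(j, d) \<in> r" "j \<noteq> d" for j
      unfolding agree_def under_def
    proof (intro ballI, rule ccontr)
      fix l assume l: "l \<in> {b. (b, j) \<in> r}" "f l \<noteq> g l"
      then have "l \<in> ?S" using r_dom by blast
      then have "(d, l) \<in> r" by (rule d(2))
      then have "(d, j) \<in> r" using l trans_r by blast
      then have "j = d"
        using that(1) wo unfolding well_order_on_def linear_order_on_def partial_order_on_def
        by (meson antisymD)
      then show False using that(2) by simp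
    qed
  qed
qed

section \<open>Extending a countable partial isometry by one point\<close>

text \<open>Let \<open>T\<close> be the initial segment of indices through which \<open>x\<close>
  agrees with some point in the domain of \<open>F\<close>, and let \<open>\<gamma>\<close> be the
  least index outside it. On \<open>T\<close> the new point copies the images of the agreeing
  points, and at \<open>\<gamma>\<close> it leaves them. These are countably many prescriptions, so
  density of \<open>Y\<close> realizes them.\<close>

lemma agree_alike_extend:
  assumes F: "countable F" "F \<subseteq> UNIV \<times> Y" "\<forall>p\<in>F. \<forall>q\<in>F. agree_alike r p q"
    and dense: "\<And>C z. countable C \<Longrightarrow> C \<subseteq> I \<Longrightarrow> \<exists>y\<in>Y. \<forall>i\<in>C. y i = z i"
  shows "\<exists>y\<in>Y. \<forall>p\<in>F. agree_alike r (x, y) p"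
\<comment> \<open>A point of the domain that agrees with \<open>x\<close> on all of \<open>I\<close>
  already has an image, which is reused.\<close>
proof (cases "\<exists>p\<in>F. \<forall>i\<in>I. agree r i x (fst p)")
  case True
  then obtain p where p: "p \<in> F" "\<forall>i\<in>I. agree r i x (fst p)" by blast
  have "agree_alike r (x, snd p) q" if "q \<in> F" for q
    using F(3) p that unfolding agree_alike_def Field_r fst_conv snd_conv
    by (meson agree_sym agree_trans)
  then show ?thesis using p(1) F(2) by fastforce
next
  case False
  define T where "T = {i \<in> I. \<exists>p\<in>F. agree r i x (fst p)}"
  have T_down: "j \<in> T" if "i \<in> T" "(j, i) \<in> r" for i j
    using that r_dom agree_mono unfolding T_def by blast
  have "\<exists>d\<in>I. \<not> agree r d x (fst p)" if "p \<in> F" for p using False that by blast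
  then obtain d where d: "\<And>p. p \<in> F \<Longrightarrow> d p \<in> I \<and> \<not> agree r (d p) x (fst p)" by metis
  \<comment> \<open>Agreement of \<open>x\<close> with \<open>fst p\<close> has broken down by
    \<open>d p\<close>, so \<open>p\<close> contributes only indices below it.\<close>
  have "T \<subseteq> (\<Union>p\<in>F. under r (d p))"
  proof
    fix i assume "i \<in> T"
    then obtain p where p: "p \<in> F" "i \<in> I" "agree r i x (fst p)" by (auto simp: T_def)
    then have "(d p, i) \<notin> r" using d agree_mono by blast
    then show "i \<in> (\<Union>p\<in>F. under r (d p))"
      using p d[OF p(1)] linear_r[of "d p" i] by (auto simp: under_def)
  qed
  then have T: "countable T"
    by (rule countable_subset) (use F(1) countable_under in simp)
  then have "\<not> I \<subseteq> T" using uncountable countable_subset by blast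
  then obtain i0 where "i0 \<in> I - T" by blast
  then obtain \<gamma> where \<gamma>: "\<gamma> \<in> I - T" "\<And>j. j \<in> I - T \<Longrightarrow> (\<gamma>, j) \<in> r"
    using least_ex[of i0 "I - T"] by blast
  \<comment> \<open>The choice of witness is immaterial: two witnesses agree through
    \<open>i\<close>, hence so do their images.\<close>
  define q where "q i = (SOME p. p \<in> F \<and> agree r i x (fst p))" for i
  have q: "q i \<in> F \<and> agree r i x (fst (q i))" if "i \<in> T" for i
    unfolding q_def by (rule someI_ex) (use that T_def in blast)
  define close where "close p \<longleftrightarrow> p \<in> F \<and> (\<forall>j\<in>underS r \<gamma>. agree r j x (fst p))" for p
  \<comment> \<open>At \<open>\<gamma>\<close> the value is opposite to the one shared by the images
    of all close points. If no point is close, the chosen pair is arbitrary and so is this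
    value.\<close>
  define z where "z i = (if i = \<gamma> then \<not> snd (SOME p. close p) \<gamma> else snd (q i) i)" for i
  obtain y where y: "y \<in> Y" "\<forall>i\<in>insert \<gamma> T. y i = z i"
    using dense[of "insert \<gamma> T" z] T \<gamma>(1) unfolding T_def by auto
  have follow: "agree r i y (snd p)" if p: "p \<in> F" "i \<in> I" "agree r i x (fst p)" for i p
    unfolding agree_def
  proof
    fix j assume "j \<in> under r i"
    then have ji: "(j, i) \<in> r" by (simp add: under_def)
    have iT: "i \<in> T" using p by (auto simp: T_def)
    have jT: "j \<in> T" using T_down[OF iT ji] .
    have jI: "j \<in> I" using jT T_def by blast
    \<comment> \<open>Both points agree with \<open>x\<close> through \<open>j\<close>, hence with
      each other, and \<open>agree_alike\<close> carries this over to their images.\<close>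
    have "agree r j (fst (q j)) (fst p)"
      using q[OF jT] agree_mono[OF p(3) ji] by (meson agree_sym agree_trans)
    then have "agree r j (snd (q j)) (snd p)"
      using F(3) q[OF jT] p(1) jI unfolding agree_alike_def Field_r by blast
    then have "snd (q j) j = snd p j" using refl_r[OF jI] by (simp add: agree_def under_def)
    moreover have "j \<noteq> \<gamma>" using jT \<gamma>(1) by blast
    ultimately show "y j = snd p j" using y(2) jT by (simp add: z_def)
  qed
  have separate: "\<not> agree r i y (snd p)" if p: "p \<in> F" "i \<in> I" "\<not> agree r i x (fst p)" for i p
  proof -
    obtain d where d: "(d, i) \<in> r" "x d \<noteq> fst p d"
      "\<And>j. (j, d) \<in> r \<Longrightarrow> j \<noteq> d \<Longrightarrow> agree r j x (fst p)"
      using first_difference[OF p(2,3)] by blast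
    have dI: "d \<in> I" using d r_dom by blast
    have nd: "\<not> agree r d x (fst p)" using d(2) refl_r[OF dI] by (auto simp: agree_def under_def)
    \<comment> \<open>It suffices to separate at the first difference \<open>d\<close>. Inside
      \<open>T\<close> the image of \<open>q d\<close>, which \<open>y\<close> follows through
      \<open>d\<close>, does so; outside \<open>T\<close> the only possibility is
      \<open>d = \<gamma>\<close>, where the flipped value does.\<close>
    have "\<not> agree r d y (snd p)"
    proof (cases "d \<in> T")
      case True
      have "\<not> agree r d (fst (q d)) (fst p)" using nd q[OF True] agree_trans by metis
      then have "\<not> agree r d (snd (q d)) (snd p)"
        using F(3) q[OF True] p(1) dI unfolding agree_alike_def Field_r by blast
      moreover have "agree r d y (snd (q d))" using follow q[OF True] dI by blast
      ultimately show ?thesis by (meson agree_sym agree_trans)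
    next
      case False
      have "d = \<gamma>"
      proof (rule ccontr)
        assume "d \<noteq> \<gamma>"
        moreover have "(\<gamma>, d) \<in> r" using False dI \<gamma>(2) by blast
        ultimately have "agree r \<gamma> x (fst p)" using d(3) by blast
        then show False using \<gamma>(1) p(1) unfolding T_def by blast
      qed
      then have cp: "close p" using d(3) p(1) by (auto simp: close_def underS_def)
      define p0 where "p0 = (SOME p. close p)"
      have c0: "close p0" unfolding p0_def using cp by (rule someI)
      \<comment> \<open>Otherwise \<open>p0\<close> would agree with \<open>x\<close> through
        \<open>\<gamma>\<close>, which would put \<open>\<gamma>\<close> into
        \<open>T\<close>.\<close>
      have n0: "x \<gamma> \<noteq> fst p0 \<gamma>"
      proof
        assume "x \<gamma> = fst p0 \<gamma>"
        moreover have "x j = fst p0 j" if "j \<in> underS r \<gamma>" for j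
        proof -
          have "(j, j) \<in> r" using that r_dom refl_r by (auto simp: underS_def)
          then show ?thesis using c0 that by (auto simp: close_def agree_def under_def)
        qed
        ultimately have "agree r \<gamma> x (fst p0)"
          unfolding agree_def under_def underS_def by (metis (mono_tags, lifting) mem_Collect_eq)
        then show False using \<gamma>(1) c0 unfolding T_def close_def by blast
      qed
      \<comment> \<open>All points close to \<open>x\<close> differ from it at \<open>\<gamma>\<close>, and only one other value is left there.\<close>
      have "agree r \<gamma> (fst p0) (fst p)"
        unfolding agree_def
      proof
        fix j assume j: "j \<in> under r \<gamma>"
        show "fst p0 j = fst p j"
        proof (cases "j = \<gamma>")
          case True
          then show ?thesis using n0 d(2) \<open>d = \<gamma>\<close> by auto
        next
          case False
          then have "j \<in> underS r \<gamma>" "j \<in> under r j"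
            using j r_dom refl_r by (auto simp: under_def underS_def)
          then show ?thesis using c0 cp unfolding close_def agree_def by metis
        qed
      qed
      then have "agree r \<gamma> (snd p0) (snd p)"
        using F(3) c0 p(1) \<gamma>(1) unfolding agree_alike_def Field_r close_def by blast
      moreover have \<gamma>\<gamma>: "\<gamma> \<in> under r \<gamma>" using \<gamma>(1) refl_r by (auto simp: under_def)
      ultimately have "snd p0 \<gamma> = snd p \<gamma>" by (simp add: agree_def)
      moreover have "y \<gamma> = (\<not> snd p0 \<gamma>)" using y(2) by (simp add: z_def p0_def)
      ultimately show ?thesis using \<gamma>\<gamma> \<open>d = \<gamma>\<close> by (auto simp: agree_def)
    qed
    then show ?thesis using agree_mono d(1) by blast
  qed
  have "agree_alike r (x, y) p" if "p \<in> F" for p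
    using follow[OF that] separate[OF that] unfolding agree_alike_def Field_r by auto
  then show ?thesis using y(1) by blast
qed

section \<open>From an isometry to a homeomorphism\<close>

lemma agree_everywhere_eq:
  assumes "f \<in> topspace (Cantor_cube I)" "g \<in> topspace (Cantor_cube I)" "\<And>i. i \<in> I \<Longrightarrow> agree r i f g"
  shows "f = g"
proof (rule extensionalityI)
  show "f \<in> extensional I" "g \<in> extensional I"
    using assms(1,2) by (auto simp: Cantor_cube_def PiE_def)
  show "f i = g i" if "i \<in> I" for i
    using assms(3)[OF that] refl_r[OF that] by (auto simp: agree_def under_def)
qed

text \<open>A neighbourhood of \<open>h x\<close> contains all points of the cube that agree with
  \<open>h x\<close> on some countable \<open>C\<close>. Once \<open>i\<close> bounds
  \<open>C\<close>, the points of \<open>X\<close> agreeing with \<open>x\<close> through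
  \<open>i\<close> form an open set that \<open>h\<close> maps into this neighbourhood.\<close>

lemma continuous_map_agree:
  assumes X: "X \<subseteq> topspace (Cantor_cube I)" and Y: "Y \<subseteq> topspace (Cantor_cube I)"
    and h: "h \<in> X \<rightarrow> Y"
    and agree: "\<And>i x x'. \<lbrakk>i \<in> I; x \<in> X; x' \<in> X; agree r i x x'\<rbrakk> \<Longrightarrow> agree r i (h x) (h x')"
  shows "continuous_map (subtopology (Gdelta_modification (Cantor_cube I)) X)
    (subtopology (Gdelta_modification (Cantor_cube I)) Y) h"
  unfolding continuous_map
proof (intro conjI allI impI)
  let ?D = "Gdelta_modification (Cantor_cube I)"
  have tX: "topspace (subtopology ?D X) = X" and tY: "topspace (subtopology ?D Y) = Y"
    using X Y by auto
  show "h ` topspace (subtopology ?D X) \<subseteq> topspace (subtopology ?D Y)"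
    unfolding tX tY using h by blast
  fix U assume "openin (subtopology ?D Y) U"
  then obtain V where V: "openin ?D V" "U = V \<inter> Y" by (auto simp: openin_subtopology)
  show "openin (subtopology ?D X) {x \<in> topspace (subtopology ?D X). h x \<in> U}"
    unfolding tX
  proof (subst openin_subopen, intro ballI)
    fix x assume "x \<in> {x \<in> X. h x \<in> U}"
    then have x: "x \<in> X" "h x \<in> V" using V by auto
    obtain C where C: "countable C" "C \<subseteq> I"
      "\<And>g. g \<in> topspace (Cantor_cube I) \<Longrightarrow> \<forall>i\<in>C. g i = h x i \<Longrightarrow> g \<in> V"
      using openin_Gdelta_Cantor_cube_support[OF V(1) x(2)] by metis
    obtain i where i: "i \<in> I" "C \<subseteq> under r i" using bounded_ex[OF C(1,2)] .
    let ?B = "{g \<in> topspace (Cantor_cube I). \<forall>j\<in>under r i. g j = x j}"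
    have "openin ?D ?B"
      using countable_under under_Field[of r i] Field_r
      by (intro openin_Gdelta_Cantor_cube_box) auto
    then have "openin (subtopology ?D X) (?B \<inter> X)" by (auto simp: openin_subtopology)
    moreover have "x \<in> ?B \<inter> X" using x X by auto
    moreover have "?B \<inter> X \<subseteq> {x \<in> X. h x \<in> U}"
    proof
      fix x' assume x': "x' \<in> ?B \<inter> X"
      then have "x' \<in> X" "agree r i x' x" by (simp_all add: agree_def)
      then have "agree r i (h x') (h x)" using agree[OF i(1) _ x(1)] by simp
      then have eq: "\<forall>j\<in>C. h x' j = h x j" using i(2) unfolding agree_def by (metis subsetD)
      have "h x' \<in> Y" using \<open>x' \<in> X\<close> h by blast
      then have "h x' \<in> V" using C(3)[OF _ eq] Y by (simp add: subsetD)
      then show "x' \<in> {x \<in> X. h x \<in> U}"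
        using \<open>x' \<in> X\<close> V(2) \<open>h x' \<in> Y\<close> by simp
    qed
    ultimately show "\<exists>T. openin (subtopology ?D X) T \<and> x \<in> T \<and> T \<subseteq> {x \<in> X. h x \<in> U}"
      by blast
  qed
qed

text \<open>Being full on both sides, \<open>F\<close> is the graph of a bijection, because points
  sharing a partner agree at every index and so coincide. Preservation of agreement in both
  directions makes the bijection and its inverse continuous.\<close>

lemma homeomorphic_agree_alike:
  assumes X: "X \<subseteq> topspace (Cantor_cube I)" and Y: "Y \<subseteq> topspace (Cantor_cube I)"
    and F: "F \<subseteq> X \<times> Y" "\<forall>p\<in>F. \<forall>q\<in>F. agree_alike r p q" "fst ` F = X" "snd ` F = Y"
  shows "subtopology (Gdelta_modification (Cantor_cube I)) X homeomorphic_space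
    subtopology (Gdelta_modification (Cantor_cube I)) Y"
proof -
  have alike: "agree r i x x' \<longleftrightarrow> agree r i y y'" if "(x, y) \<in> F" "(x', y') \<in> F" "i \<in> I" for x y x' y' i
  proof -
    have "agree_alike r (x, y) (x', y')" using F(2) that by blast
    then show ?thesis using that(3) by (simp add: agree_alike_def Field_r)
  qed
  have "\<exists>y. (x, y) \<in> F" if "x \<in> X" for x using F(3) that by force
  then obtain h where h: "\<And>x. x \<in> X \<Longrightarrow> (x, h x) \<in> F" by metis
  have "\<exists>x. (x, y) \<in> F" if "y \<in> Y" for y using F(4) that by force
  then obtain k where k: "\<And>y. y \<in> Y \<Longrightarrow> (k y, y) \<in> F" by metis
  have hXY: "h \<in> X \<rightarrow> Y" and kYX: "k \<in> Y \<rightarrow> X" using F(1) h k by auto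
  have "k (h x) = x" if "x \<in> X" for x
  proof (rule agree_everywhere_eq)
    fix i assume "i \<in> I"
    \<comment> \<open>The pairs \<open>(k (h x), h x)\<close> and \<open>(x, h x)\<close> share
      their second coordinate, so their first coordinates agree through every index.\<close>
    then show "agree r i (k (h x)) x" using alike[OF k h[OF that], of "h x" i] hXY that by auto
  qed (use that hXY kYX X in auto)
  moreover have "h (k y) = y" if "y \<in> Y" for y
  proof (rule agree_everywhere_eq)
    fix i assume "i \<in> I"
    then show "agree r i (h (k y)) y" using alike[OF h k[OF that], of "k y" i] kYX that by auto
  qed (use that hXY kYX Y in auto)
  moreover have "continuous_map (subtopology (Gdelta_modification (Cantor_cube I)) X)
    (subtopology (Gdelta_modification (Cantor_cube I)) Y) h"
    using continuous_map_agree[OF X Y hXY] alike h by blast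
  moreover have "continuous_map (subtopology (Gdelta_modification (Cantor_cube I)) Y)
    (subtopology (Gdelta_modification (Cantor_cube I)) X) k"
    using continuous_map_agree[OF Y X kYX] alike k by blast
  ultimately show ?thesis
    unfolding homeomorphic_space_def homeomorphic_maps_def
    by (intro exI[of _ h] exI[of _ k]) auto
qed

end

section \<open>The order from the Continuum Hypothesis, and the homeomorphism\<close>

text \<open>\<open>|I|\<close> is a cardinal order, so its proper initial segments have smaller
  cardinality; below omega_1 this means countable.\<close>

lemma omega1_order_card_of:
  assumes "|I| =o cardSuc natLeq"
  shows "omega1_order I |I|"
proof
  show "well_order_on I |I|" by (rule card_of_well_order_on)
  have "natLeq <o |I|"
    using cardSuc_greater[OF natLeq_Card_order] assms ordIso_symmetric ordLess_ordIso_trans by blast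
  then show "uncountable I"
    unfolding countable_card_le_natLeq using not_ordLess_ordLeq by blast
  fix i :: 'a
  show "countable (underS |I| i)"
  proof (cases "i \<in> I")
    case True
    then have "|underS |I| i| <o |I|"
      using card_of_underS[OF card_of_Card_order] by (simp add: Field_card_of)
    then have "|underS |I| i| <o cardSuc natLeq" using assms ordLess_ordIso_trans by blast
    then show ?thesis
      unfolding countable_card_le_natLeq
      using cardSuc_ordLeq_ordLess[OF natLeq_Card_order card_of_Card_order] by blast
  next
    case False
    then have "underS |I| i = {}"
      using Field_card_of[of I] FieldI2 unfolding underS_def by fastforce
    then show ?thesis by simp
  qed
qed

theorem theorem13:
  fixes I :: "'i set" and X Y :: "('i \<Rightarrow> bool) set"
  assumes "Continuum_Hypothesis"
    and "|I| =o continuum"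
    and "dense_in (Gdelta_modification (Cantor_cube I)) X" and "|X| =o continuum"
    and "dense_in (Gdelta_modification (Cantor_cube I)) Y" and "|Y| =o continuum"
  shows "subtopology (Gdelta_modification (Cantor_cube I)) X homeomorphic_space
         subtopology (Gdelta_modification (Cantor_cube I)) Y"
proof -
  \<comment> \<open>The Continuum Hypothesis enters here, making the order type of the index set
    omega_1.\<close>
  have "|I| =o cardSuc natLeq"
    using assms(1,2) ordIso_transitive unfolding Continuum_Hypothesis_def by blast
  then interpret omega1_order I "|I|" by (rule omega1_order_card_of)
  \<comment> \<open>Equal cardinality lets \<open>I\<close> enumerate both \<open>X\<close> and
    \<open>Y\<close>, so one recursion along \<open>I\<close> exhausts them.\<close>
  have "|I| =o |X|" "|I| =o |Y|"
    using assms(2,4,6) ordIso_transitive ordIso_symmetric by blast+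
  then obtain a b where "bij_betw a I X" "bij_betw b I Y"
    unfolding card_of_ordIso[symmetric] by blast
  then have ab: "X = a ` I" "Y = b ` I" by (auto simp: bij_betw_def)
  note denseX = dense_in_Gdelta_Cantor_cubeD[OF assms(3)]
  note denseY = dense_in_Gdelta_Cantor_cubeD[OF assms(5)]
  obtain F where F: "F \<subseteq> X \<times> Y" "\<forall>p\<in>F. \<forall>q\<in>F. agree_alike |I| p q" "fst ` F = X" "snd ` F = Y"
  proof (rule transfinite_back_and_forth[OF wo countable_underS ab, of "agree_alike |I|"])
    fix F x
    assume F: "countable F" "F \<subseteq> X \<times> Y" "\<forall>p\<in>F. \<forall>q\<in>F. agree_alike |I| p q"
    have "F \<subseteq> UNIV \<times> Y" using F(2) by blast
    from agree_alike_extend[OF F(1) this F(3) denseY]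
    obtain y where "y \<in> Y" "\<forall>p\<in>F. agree_alike |I| (x, y) p" by blast
    with F(3) show "\<exists>y\<in>Y. \<forall>p\<in>insert (x, y) F. \<forall>q\<in>insert (x, y) F. agree_alike |I| p q"
      by (intro bexI[of _ y]) (auto intro: agree_alike_sym)
  next
    fix F y
    assume F: "countable F" "F \<subseteq> X \<times> Y" "\<forall>p\<in>F. \<forall>q\<in>F. agree_alike |I| p q"
    \<comment> \<open>The backward step is the extension lemma for the inverse relation, with
      density of \<open>X\<close> in place of that of \<open>Y\<close>.\<close>
    let ?F = "prod.swap ` F"
    have "countable ?F" "?F \<subseteq> UNIV \<times> X" "\<forall>p\<in>?F. \<forall>q\<in>?F. agree_alike |I| p q"
      using F by (auto simp: image_iff)
    from agree_alike_extend[OF this denseX]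
    obtain x where x: "x \<in> X" "\<forall>p\<in>?F. agree_alike |I| (y, x) p" by blast
    have "agree_alike |I| (x, y) p" if "p \<in> F" for p
      using x(2) that agree_alike_swap[of "|I|" "(x, y)" p] by auto
    with F(3) x(1) show "\<exists>x\<in>X. \<forall>p\<in>insert (x, y) F. \<forall>q\<in>insert (x, y) F. agree_alike |I| p q"
      by (intro bexI[of _ x]) (auto intro: agree_alike_sym)
  qed
  show ?thesis
  proof (rule homeomorphic_agree_alike[OF _ _ F])
    show "X \<subseteq> topspace (Cantor_cube I)" "Y \<subseteq> topspace (Cantor_cube I)"
      using assms(3,5) by (simp_all add: dense_in_def)
  qed
qed

end
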